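(* There exists a commutative ring $R$ having a purely-prime ideal which is not purely-maximal.
   Context: Rings are commutative with identity. An ideal $I$ of a ring $R$ is called a pure ideal if $R/I$ is a flat $R$-module, or equivalently, if for each $a\in I$ there exists some $b\in I$ such that $a(1-b)=0$. The zero ideal and $R$ itself are always pure. A purely-prime ideal of $R$ is a proper pure ideal $I$ of $R$ such that whenever $J$ and $J'$ are pure ideals of $R$ with $JJ'\subseteq I$, then $J\subseteq I$ or $J'\subseteq I$. A purely-maximal ideal of $R$ is a proper pure ideal of $R$ that is a maximal element (with respect to inclusion) of the set of proper pure ideals of $R$. *)

theory Defs
  imports Complex_Main "HOL-Algebra.Ideal_Product"
begin

(* Purity of I is flatness of R/I, here in its elementwise form: every a in I has
   some b in I with a(1 - b) = 0. *)
locale pure_ideal = ideal + cring +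
  assumes pure: "a \<in> I \<Longrightarrow> \<exists>b\<in>I. a \<otimes> (\<one> \<ominus> b) = \<zero>"

locale purely_prime_ideal = pure_ideal +
  assumes I_notcarr: "I \<noteq> carrier R"
    and I_purely_prime:
      "\<lbrakk>pure_ideal J R; pure_ideal J' R; J \<cdot> J' \<subseteq> I\<rbrakk> \<Longrightarrow> J \<subseteq> I \<or> J' \<subseteq> I"

locale purely_maximal_ideal = pure_ideal +
  assumes I_notcarr: "I \<noteq> carrier R"
    and I_purely_maximal:
      "\<lbrakk>pure_ideal J R; J \<noteq> carrier R; I \<subseteq> J\<rbrakk> \<Longrightarrow> J = I"

end

theory Submission
  imports Defs "HOL-Computational_Algebra.Polynomial"
begin

text \<open>
  Take the ring of functions on the line that are polynomial on each interval $[n, n+1]$. If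
  $b = 1$ on $[n, n+1]$ and $b (1 - c) = 0$, then $b$ is a nonzero polynomial on $[n+1, n+2]$,
  having the value $1$ at $n+1$, so $c = 1$ there. Hence purity propagates to the right: every
  nonzero pure ideal contains, for all large $n$, an element equal to $1$ on $[n, n+1]$. Two
  nonzero pure ideals thus have nonzero product, and the zero ideal is purely-prime. It is not
  purely-maximal, because the functions vanishing near $+\infty$ form a proper pure ideal.
\<close>

text \<open>The intervals are closed, so neighbours share an endpoint and the polynomials on both
  sides must agree there. This makes the functions continuous and lets a value at n + 1 pass from
  one interval to the next.\<close>

definition piecewise_poly :: "(real \<Rightarrow> real) set" where
  "piecewise_poly =
     {f. \<forall>n::int. \<exists>p. \<forall>x\<in>{real_of_int n..real_of_int n + 1}. f x = poly p x}"

definition piecewise_poly_ring :: "(real \<Rightarrow> real) ring" ("PP") where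
  "PP =
     \<lparr>carrier = piecewise_poly, monoid.mult = (\<lambda>f g x. f x * g x), one = (\<lambda>x. 1),
      zero = (\<lambda>x. 0), add = (\<lambda>f g x. f x + g x)\<rparr>"

definition eventually_zero_ideal :: "(real \<Rightarrow> real) set" where
  "eventually_zero_ideal = {f \<in> piecewise_poly. eventually (\<lambda>x. f x = 0) at_top}"

lemma piecewise_polyE:
  assumes "f \<in> piecewise_poly"
  obtains p where "\<And>x. x \<in> {real_of_int n..real_of_int n + 1} \<Longrightarrow> f x = poly p x"
  using assms unfolding piecewise_poly_def by blast

lemma piecewise_poly_const: "(\<lambda>x. c) \<in> piecewise_poly"
  unfolding piecewise_poly_def by (auto intro!: exI[of _ "[:c:]"])

lemma piecewise_poly_add:
  assumes "f \<in> piecewise_poly" "g \<in> piecewise_poly"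
  shows "(\<lambda>x. f x + g x) \<in> piecewise_poly"
  unfolding piecewise_poly_def
proof (intro CollectI allI)
  fix n :: int
  obtain p where "\<And>x. x \<in> {real_of_int n..real_of_int n + 1} \<Longrightarrow> f x = poly p x"
    using piecewise_polyE[OF assms(1)] by blast
  moreover obtain q where "\<And>x. x \<in> {real_of_int n..real_of_int n + 1} \<Longrightarrow> g x = poly q x"
    using piecewise_polyE[OF assms(2)] by blast
  ultimately show "\<exists>p. \<forall>x\<in>{real_of_int n..real_of_int n + 1}. f x + g x = poly p x"
    by (intro exI[of _ "p + q"]) simp
qed

lemma piecewise_poly_mult:
  assumes "f \<in> piecewise_poly" "g \<in> piecewise_poly"
  shows "(\<lambda>x. f x * g x) \<in> piecewise_poly"
  unfolding piecewise_poly_def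
proof (intro CollectI allI)
  fix n :: int
  obtain p where "\<And>x. x \<in> {real_of_int n..real_of_int n + 1} \<Longrightarrow> f x = poly p x"
    using piecewise_polyE[OF assms(1)] by blast
  moreover obtain q where "\<And>x. x \<in> {real_of_int n..real_of_int n + 1} \<Longrightarrow> g x = poly q x"
    using piecewise_polyE[OF assms(2)] by blast
  ultimately show "\<exists>p. \<forall>x\<in>{real_of_int n..real_of_int n + 1}. f x * g x = poly p x"
    by (intro exI[of _ "p * q"]) simp
qed

lemma piecewise_poly_uminus:
  assumes "f \<in> piecewise_poly"
  shows "(\<lambda>x. - f x) \<in> piecewise_poly"
  using piecewise_poly_mult[OF piecewise_poly_const[of "-1"] assms] by simp

text \<open>The ramp is 1 up to m, falls linearly to 0 on [m, m+1] and stays 0 afterwards. Both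
  corners are integers, so each interval [n, n+1] meets only one of the three branches.\<close>

lemma piecewise_poly_ramp:
  "(\<lambda>x. max 0 (min 1 (real_of_int m + 1 - x))) \<in> piecewise_poly"
  unfolding piecewise_poly_def
proof (intro CollectI allI)
  fix n :: int
  consider "n < m" | "n = m" | "n > m" by linarith
  then show "\<exists>p. \<forall>x\<in>{real_of_int n..real_of_int n + 1}.
      max 0 (min 1 (real_of_int m + 1 - x)) = poly p x"
  proof cases
    case 1
    then show ?thesis by (intro exI[of _ 1]) (auto simp: min_def)
  next
    case 2
    then show ?thesis by (intro exI[of _ "[:real_of_int m + 1, -1:]"]) auto
  next
    case 3
    then show ?thesis by (intro exI[of _ 0]) (auto simp: max_def min_def)
  qed
qed

lemma PP_simps [simp]:
  "carrier PP = piecewise_poly" "f \<otimes>\<^bsub>PP\<^esub> g = (\<lambda>x. f x * g x)"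
  "f \<oplus>\<^bsub>PP\<^esub> g = (\<lambda>x. f x + g x)" "\<one>\<^bsub>PP\<^esub> = (\<lambda>x. 1)" "\<zero>\<^bsub>PP\<^esub> = (\<lambda>x. 0)"
  by (simp_all add: piecewise_poly_ring_def)

lemma cring_PP: "cring PP"
proof (rule cringI)
  show "abelian_group PP"
  proof (rule abelian_groupI)
    fix f assume "f \<in> carrier PP"
    then show "\<exists>g\<in>carrier PP. g \<oplus>\<^bsub>PP\<^esub> f = \<zero>\<^bsub>PP\<^esub>"
      by (intro bexI[of _ "\<lambda>x. - f x"]) (auto simp: piecewise_poly_uminus)
  qed (auto simp: piecewise_poly_add piecewise_poly_const add_ac)
  show "comm_monoid PP"
    by (rule comm_monoidI) (auto simp: piecewise_poly_mult piecewise_poly_const mult_ac)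
qed (simp add: distrib_right)

interpretation PP: cring PP by (rule cring_PP)

lemma PP_a_inv: "f \<in> piecewise_poly \<Longrightarrow> \<ominus>\<^bsub>PP\<^esub> f = (\<lambda>x. - f x)"
  by (rule sym, rule PP.sum_zero_eq_neg) (auto simp: piecewise_poly_uminus)

lemma PP_minus: "g \<in> piecewise_poly \<Longrightarrow> f \<ominus>\<^bsub>PP\<^esub> g = (\<lambda>x. f x - g x)"
  by (simp add: a_minus_def PP_a_inv)

lemma poly_eq_0_of_interval:
  fixes p :: "real poly"
  assumes "a < b" "\<And>x. x \<in> {a..b} \<Longrightarrow> poly p x = 0"
  shows "p = 0"
proof (rule ccontr)
  assume "p \<noteq> 0"
  then have "finite {x. poly p x = 0}" by (rule poly_roots_finite)
  moreover have "{a..b} \<subseteq> {x. poly p x = 0}" using assms(2) by blast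
  ultimately show False using assms(1) finite_subset infinite_Icc by blast
qed

text \<open>On a single interval the elements restrict to polynomials, which form an integral
  domain: the two polynomials have a product with infinitely many roots, and the first one is
  nonzero because of its value at y.\<close>

lemma piecewise_poly_mult_eq_0:
  assumes f: "f \<in> piecewise_poly" and g: "g \<in> piecewise_poly"
    and fg: "\<And>x. f x * g x = 0"
    and y: "y \<in> {real_of_int n..real_of_int n + 1}" "f y \<noteq> 0"
    and x: "x \<in> {real_of_int n..real_of_int n + 1}"
  shows "g x = 0"
proof -
  obtain p where p: "\<And>x. x \<in> {real_of_int n..real_of_int n + 1} \<Longrightarrow> f x = poly p x"
    using piecewise_polyE[OF f] by blast
  obtain q where q: "\<And>x. x \<in> {real_of_int n..real_of_int n + 1} \<Longrightarrow> g x = poly q x"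
    using piecewise_polyE[OF g] by blast
  have "p * q = 0"
  proof (rule poly_eq_0_of_interval)
    fix x assume "x \<in> {real_of_int n..real_of_int n + 1}"
    then show "poly (p * q) x = 0" using fg[of x] p q by simp
  qed simp
  moreover have "p \<noteq> 0" using p y by auto
  ultimately show ?thesis using q x by simp
qed

text \<open>Purity yields g in J with f (1 - g) = 0. Since f is not identically zero on the
  interval, the factor 1 - g has to vanish on all of it.\<close>

lemma pure_ideal_PP_unit:
  assumes J: "pure_ideal J PP" and f: "f \<in> J"
    and y: "y \<in> {real_of_int n..real_of_int n + 1}" "f y \<noteq> 0"
  shows "\<exists>g\<in>J. \<forall>x\<in>{real_of_int n..real_of_int n + 1}. g x = 1"
proof -
  interpret J: pure_ideal J PP by (rule J)
  obtain g where g: "g \<in> J" "f \<otimes>\<^bsub>PP\<^esub> (\<one>\<^bsub>PP\<^esub> \<ominus>\<^bsub>PP\<^esub> g) = \<zero>\<^bsub>PP\<^esub>"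
    using J.pure[OF f] by blast
  have fg: "f \<in> piecewise_poly" "g \<in> piecewise_poly"
    using J.a_subset f g(1) by auto
  then have 1: "(\<lambda>x. 1 - g x) \<in> piecewise_poly"
    using piecewise_poly_add[OF piecewise_poly_const[of 1] piecewise_poly_uminus[OF fg(2)]]
    by simp
  have "f x * (1 - g x) = 0" for x
    using fun_cong[OF g(2), of x] fg(2) by (simp add: PP_minus)
  then have "1 - g x = 0" if "x \<in> {real_of_int n..real_of_int n + 1}" for x
    using piecewise_poly_mult_eq_0[OF fg(1) 1 _ y that] by simp
  then show ?thesis using g(1) by (intro bexI[of _ g]) auto
qed

lemma pure_ideal_PP_unit_right:
  assumes J: "pure_ideal J PP" and f: "f \<in> J"
    and y: "y \<in> {real_of_int n..real_of_int n + 1}" "f y \<noteq> 0"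
    and "n \<le> m"
  shows "\<exists>g\<in>J. \<forall>x\<in>{real_of_int m..real_of_int m + 1}. g x = 1"
  using \<open>n \<le> m\<close>
proof (induction m rule: int_ge_induct)
  case base
  show ?case by (rule pure_ideal_PP_unit[OF J f y])
next
  case (step m)
  then obtain g where "g \<in> J" "\<forall>x\<in>{real_of_int m..real_of_int m + 1}. g x = 1"
    by blast
  then show ?case
    \<comment> \<open>The point m + 1 belongs to [m, m+1], where g is 1, and also to [m+1, m+2]; so
      g is nonzero somewhere on the next interval.\<close>
    by (intro pure_ideal_PP_unit[OF J, of g "real_of_int m + 1"]) auto
qed

text \<open>A threshold instead of a single interval allows two ideals to be compared on a common
  interval. It is the floor of a point where some element of J is nonzero.\<close>

lemma nonzero_pure_ideal_PP:
  assumes J: "pure_ideal J PP" and "\<not> J \<subseteq> {\<zero>\<^bsub>PP\<^esub>}"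
  obtains n where
    "\<And>m. n \<le> m \<Longrightarrow> \<exists>g\<in>J. \<forall>x\<in>{real_of_int m..real_of_int m + 1}. g x = 1"
proof -
  obtain f y where f: "f \<in> J" "f y \<noteq> 0"
    using assms(2) by (auto simp: fun_eq_iff)
  have "y \<in> {real_of_int \<lfloor>y\<rfloor>..real_of_int \<lfloor>y\<rfloor> + 1}"
    by (auto intro: less_imp_le)
  from pure_ideal_PP_unit_right[OF J f(1) this f(2)] that show thesis by blast
qed

lemma pure_ideal_zero:
  assumes "cring R"
  shows "pure_ideal {\<zero>\<^bsub>R\<^esub>} R"
proof -
  interpret cring R by (rule assms)
  show ?thesis
    by (intro pure_ideal.intro pure_ideal_axioms.intro zeroideal assms) auto
qed

lemma purely_prime_zero_PP: "purely_prime_ideal {\<zero>\<^bsub>PP\<^esub>} PP"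
proof (intro purely_prime_ideal.intro purely_prime_ideal_axioms.intro)
  show "pure_ideal {\<zero>\<^bsub>PP\<^esub>} PP" by (rule pure_ideal_zero[OF cring_PP])
  have "\<one>\<^bsub>PP\<^esub> \<noteq> \<zero>\<^bsub>PP\<^esub>" by (simp add: fun_eq_iff)
  then show "{\<zero>\<^bsub>PP\<^esub>} \<noteq> carrier PP" using PP.one_closed by blast
next
  fix J J'
  assume J: "pure_ideal J PP" and J': "pure_ideal J' PP"
    and prod: "J \<cdot>\<^bsub>PP\<^esub> J' \<subseteq> {\<zero>\<^bsub>PP\<^esub>}"
  show "J \<subseteq> {\<zero>\<^bsub>PP\<^esub>} \<or> J' \<subseteq> {\<zero>\<^bsub>PP\<^esub>}"
  proof (rule ccontr)
    assume contra: "\<not> ?thesis"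
    obtain n where n:
      "\<And>m. n \<le> m \<Longrightarrow> \<exists>g\<in>J. \<forall>x\<in>{real_of_int m..real_of_int m + 1}. g x = 1"
      using nonzero_pure_ideal_PP[OF J] contra by blast
    obtain n' where n':
      "\<And>m. n' \<le> m \<Longrightarrow> \<exists>g\<in>J'. \<forall>x\<in>{real_of_int m..real_of_int m + 1}. g x = 1"
      using nonzero_pure_ideal_PP[OF J'] contra by blast
    \<comment> \<open>Beyond both thresholds each ideal has an element equal to 1 on [m, m+1];
      evaluating their product at m alone already gives 1.\<close>
    define m where "m = max n n'"
    obtain g where g: "g \<in> J" "g (real_of_int m) = 1"
      using n[of m] by (auto simp: m_def)
    obtain g' where g': "g' \<in> J'" "g' (real_of_int m) = 1"
      using n'[of m] by (auto simp: m_def)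
    have "g \<otimes>\<^bsub>PP\<^esub> g' = \<zero>\<^bsub>PP\<^esub>"
      using ideal_prod.prod[OF g(1) g'(1), of PP] prod by blast
    from fun_cong[OF this, of "real_of_int m"] show False using g g' by simp
  qed
qed

lemma ramp_eventually_zero:
  "(\<lambda>x. max 0 (min 1 (real_of_int m + 1 - x))) \<in> eventually_zero_ideal"
  unfolding eventually_zero_ideal_def
  by (auto simp: piecewise_poly_ramp eventually_at_top_linorder
      intro!: exI[of _ "real_of_int m + 1"])

lemma pure_ideal_eventually_zero: "pure_ideal eventually_zero_ideal PP"
proof (intro pure_ideal.intro pure_ideal_axioms.intro cring_PP)
  show "ideal eventually_zero_ideal PP"
  proof (rule idealI)
    show "subgroup eventually_zero_ideal (add_monoid PP)"
    proof (rule PP.add.subgroupI)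
      show "eventually_zero_ideal \<noteq> {}" using ramp_eventually_zero by blast
    qed (auto simp: eventually_zero_ideal_def piecewise_poly_uminus piecewise_poly_add
        PP_a_inv[unfolded a_inv_def] PP_a_inv elim: eventually_elim2)
  qed (auto simp: eventually_zero_ideal_def piecewise_poly_mult PP.ring_axioms
      elim: eventually_mono)
next
  fix f assume f: "f \<in> eventually_zero_ideal"
  then obtain N where N: "\<And>x. N \<le> x \<Longrightarrow> f x = 0"
    by (auto simp: eventually_zero_ideal_def eventually_at_top_linorder)
  \<comment> \<open>The ramp must start at an integer; rounding N up keeps b equal to 1 at every x <
    N, while f vanishes from N on. Hence f (1 - b) = 0 everywhere.\<close>
  define b where "b = (\<lambda>x. max 0 (min 1 (real_of_int \<lceil>N\<rceil> + 1 - x)))"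
  have b: "b \<in> eventually_zero_ideal" unfolding b_def by (rule ramp_eventually_zero)
  have "f x * (1 - b x) = 0" for x
  proof (cases "N \<le> x")
    case False
    then have "x \<le> real_of_int \<lceil>N\<rceil>" by linarith
    then show ?thesis by (simp add: b_def)
  qed (simp add: N)
  then show "\<exists>b\<in>eventually_zero_ideal. f \<otimes>\<^bsub>PP\<^esub> (\<one>\<^bsub>PP\<^esub> \<ominus>\<^bsub>PP\<^esub> b) = \<zero>\<^bsub>PP\<^esub>"
    using b by (intro bexI[of _ b]) (auto simp: eventually_zero_ideal_def PP_minus)
qed

text \<open>The ideal \<open>eventually_zero_ideal\<close> lies strictly between zero and the ring:
  it omits the constant 1 and contains the ramp with m = 0, whose value at 0 is 1.\<close>

lemma not_purely_maximal_zero_PP: "\<not> purely_maximal_ideal {\<zero>\<^bsub>PP\<^esub>} PP"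
proof
  assume "purely_maximal_ideal {\<zero>\<^bsub>PP\<^esub>} PP"
  then interpret M: purely_maximal_ideal "{\<zero>\<^bsub>PP\<^esub>}" PP .
  have "(\<lambda>x. 1) \<notin> eventually_zero_ideal"
    by (simp add: eventually_zero_ideal_def)
  then have "eventually_zero_ideal \<noteq> carrier PP"
    using piecewise_poly_const[of 1] by auto
  moreover have "{\<zero>\<^bsub>PP\<^esub>} \<subseteq> eventually_zero_ideal"
    by (simp add: eventually_zero_ideal_def piecewise_poly_const)
  ultimately have "eventually_zero_ideal = {\<lambda>x. 0}"
    using M.I_purely_maximal pure_ideal_eventually_zero by simp
  then have "(\<lambda>x. max 0 (min 1 (real_of_int 0 + 1 - x))) = (\<lambda>x. 0 :: real)"
    using ramp_eventually_zero[of 0] by blast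
  from fun_cong[OF this, of 0] show False by simp
qed

theorem theorem2p5:
  shows "\<exists>(R :: (real \<Rightarrow> real) ring) I.
           cring R \<and> purely_prime_ideal I R \<and> \<not> purely_maximal_ideal I R"
  using cring_PP purely_prime_zero_PP not_purely_maximal_zero_PP by blast

end
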